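(* Let $p$ be a prime greater than $5$. Then $$\sum_{k=0}^{[p/3]}\frac{(3k)!}{54^k\,k!^3}\equiv\begin{cases}0\pmod p&\text{if }6\mid p-5,\\ 2A\pmod p&\text{if }6\mid p-1\text{ and }p=A^2+3B^2\text{ with }A,B\in\mathbb Z,\ 3\mid A-1,\end{cases}$$ and $$\sum_{k=0}^{[p/3]}\frac{k\,(3k)!}{54^k\,k!^3}\equiv\begin{cases}0\pmod p&\text{if }6\mid p-1,\\ \frac13(-1)^{\frac{p+1}6}2^{-\frac{p+1}3}\binom{(p+1)/3}{(p+1)/6}\pmod p&\text{if }6\mid p-5.\end{cases}$$
   Context: $[y]$ is the greatest integer not exceeding $y$. Congruences are between rational numbers whose denominators are prime to $p$. *)

theory Defs
  imports Complex_Main "HOL-Number_Theory.Number_Theory"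
begin

definition rat_cong :: "rat \<Rightarrow> rat \<Rightarrow> int \<Rightarrow> bool" where
  "rat_cong q r p \<longleftrightarrow>
     (case quotient_of (q - r) of (a, b) \<Rightarrow> coprime b p \<and> p dvd a)"

end

theory Submission
  imports Defs
begin

text \<open>Put \<open>n = [p/3]\<close>. Comparing term ratios modulo \<open>p\<close> turns the first sum into \<open>P\<^sub>n(0)\<close> and
  the second into \<open>-P\<^sub>n'(0)\<close>, where \<open>P\<^sub>n\<close> is the Legendre polynomial; one of the two vanishes according to
  the parity of \<open>n\<close>, and the other is a central binomial coefficient up to a simple factor.
  For \<open>p = 6m + 1\<close> this gives the binomial coefficient of \<open>3m\<close> over \<open>m\<close>, which modulo \<open>p\<close> is the
  negative of \<open>S(1)\<close>, where \<open>S(a)\<close> is the sum of the Legendre symbols of \<open>x\<^sup>3 + a\<close>.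
  The three values of \<open>\<chi>(a) S(a)\<close> on the cubic residue classes add up to \<open>0\<close> and their squares to
  \<open>6p\<close>. With \<open>S(1) = -2A\<close> this forces \<open>p = A\<^sup>2 + 3B\<^sup>2\<close>, and counting
  modulo \<open>6\<close> fixes the sign of \<open>A\<close>.\<close>

subsection \<open>Congruences between rational numbers\<close>

text \<open>Any fraction with denominator prime to \<open>p\<close> certifies a congruence, reduced
  or not: the reduced denominator divides every other one and so inherits coprimality to
  \<open>p\<close>.\<close>

lemma rat_cong_iff:
  assumes "prime p"
  shows "rat_cong q r p \<longleftrightarrow> (\<exists>a b. coprime b p \<and> p dvd a \<and> q - r = of_int a / of_int b)"
proof
  assume "rat_cong q r p"
  then show "\<exists>a b. coprime b p \<and> p dvd a \<and> q - r = of_int a / of_int b"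
    unfolding rat_cong_def by (cases "quotient_of (q - r)") (auto dest!: quotient_of_div)
next
  assume "\<exists>a b. coprime b p \<and> p dvd a \<and> q - r = of_int a / of_int b"
  then obtain a b where ab: "coprime b p" "p dvd a" "q - r = of_int a / of_int b" by blast
  obtain c d where cd: "quotient_of (q - r) = (c, d)" by fastforce
  have "b \<noteq> 0" using ab(1) assms by auto
  have "d > 0" "coprime c d" "q - r = of_int c / of_int d"
    using quotient_of_denom_pos[OF cd] quotient_of_coprime[OF cd] quotient_of_div[OF cd] by auto
  then have "(of_int c * of_int b :: rat) = of_int a * of_int d"
    using ab(3) \<open>b \<noteq> 0\<close> by (simp add: field_simps)
  then have eq: "c * b = a * d" by (simp flip: of_int_mult)
  then have "d dvd b"
    using \<open>coprime c d\<close> by (metis coprime_commute coprime_dvd_mult_right_iff dvd_triv_right)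
  then have "coprime d p" using ab(1) by (meson coprime_divisors dvd_refl)
  moreover have "p dvd c * b" using eq ab(2) by simp
  then have "p dvd c" using ab(1) by (simp add: coprime_commute coprime_dvd_mult_left_iff)
  ultimately show "rat_cong q r p" by (simp add: rat_cong_def cd)
qed

lemma rat_congI:
  assumes "prime p" "coprime b p" "p dvd a" "q - r = of_int a / of_int b"
  shows "rat_cong q r p"
  using assms by (auto simp: rat_cong_iff)

lemma rat_cong_refl: "rat_cong q q p"
  by (simp add: rat_cong_def)

lemma rat_cong_of_int: "[a = b] (mod p) \<Longrightarrow> prime p \<Longrightarrow> rat_cong (of_int a) (of_int b) p"
  by (rule rat_congI[where b = 1 and a = "a - b"]) (auto simp: cong_iff_dvd_diff)

lemma rat_cong_add:
  assumes p: "prime p" and "rat_cong q r p" "rat_cong s t p"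
  shows "rat_cong (q + s) (r + t) p"
proof -
  obtain a b where ab: "coprime b p" "p dvd a" "q - r = of_int a / of_int b"
    using assms by (auto simp: rat_cong_iff)
  obtain c d where cd: "coprime d p" "p dvd c" "s - t = of_int c / of_int d"
    using assms by (auto simp: rat_cong_iff)
  have "b \<noteq> 0" "d \<noteq> 0" using ab cd p by auto
  have "(q + s) - (r + t) = (q - r) + (s - t)" by simp
  also have "\<dots> = of_int (a * d + c * b) / of_int (b * d)"
    unfolding ab(3) cd(3) using \<open>b \<noteq> 0\<close> \<open>d \<noteq> 0\<close> by (simp add: field_simps)
  finally have "(q + s) - (r + t) = of_int (a * d + c * b) / of_int (b * d)" .
  then show ?thesis
    using ab cd by (intro rat_congI[OF p, of "b * d" "a * d + c * b"]) auto
qed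

lemma rat_cong_trans:
  assumes "prime p" and "rat_cong q r p" "rat_cong r s p"
  shows "rat_cong q s p"
  using rat_cong_add[OF assms] by (simp add: rat_cong_def algebra_simps)

lemma rat_cong_mult_left:
  assumes p: "prime p" and "rat_cong q r p" and "coprime d p"
  shows "rat_cong (of_int c / of_int d * q) (of_int c / of_int d * r) p"
proof -
  obtain a b where ab: "coprime b p" "p dvd a" "q - r = of_int a / of_int b"
    using assms by (auto simp: rat_cong_iff)
  have "of_int c / of_int d * q - of_int c / of_int d * r = of_int c / of_int d * (q - r)"
    by (rule right_diff_distrib[symmetric])
  also have "\<dots> = of_int (c * a) / of_int (d * b)"
    by (simp add: ab(3))
  finally show ?thesis
    using ab assms by (intro rat_congI[OF p, of "d * b" "c * a"]) auto
qed

lemma rat_cong_sum: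
  assumes "prime p" and "\<And>k. k \<in> K \<Longrightarrow> rat_cong (f k) (g k) p"
  shows "rat_cong (\<Sum>k\<in>K. f k) (\<Sum>k\<in>K. g k) p"
  using assms(2)
  by (induction K rule: infinite_finite_induct)
     (auto intro: rat_cong_add[OF assms(1)] rat_cong_refl)

subsection \<open>Legendre polynomials at zero\<close>

text \<open>With \<open>P\<^sub>n\<close> the \<open>n\<close>-th Legendre polynomial, \<open>legendre_term n k\<close> is the \<open>k\<close>-th term of
  \<open>P\<^sub>n(0)\<close> in the expansion of \<open>P\<^sub>n(1 - 2x)\<close> around \<open>x = 0\<close>, and the sum of \<open>k * legendre_term n k\<close>
  is \<open>-P\<^sub>n'(0)\<close>.\<close>

definition legendre_term :: "nat \<Rightarrow> nat \<Rightarrow> rat" where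
  "legendre_term n k = of_nat (n choose k) * of_nat ((n + k) choose k) * (-1/2) ^ k"

definition legendre_0 :: "nat \<Rightarrow> rat" where
  "legendre_0 n = (\<Sum>k\<le>n. legendre_term n k)"

definition legendre_0' :: "nat \<Rightarrow> rat" where
  "legendre_0' n = (\<Sum>k\<le>n. of_nat k * legendre_term n k)"

text \<open>An intermediate between degrees \<open>n\<close> and \<open>n - 1\<close>: multiplying
  by \<open>(n + k) / n\<close> or \<open>(n - k) / n\<close> gives the Legendre term of degree
  \<open>n\<close> or \<open>n - 1\<close>. Sums for consecutive degrees thus acquire a common
  factor.\<close>

definition legendre_aux :: "nat \<Rightarrow> nat \<Rightarrow> rat" where
  "legendre_aux n k = of_nat (n choose k) * of_nat ((n + k - 1) choose k) * (-1/2) ^ k"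

lemma of_nat_binomial_Suc:
  "of_nat (Suc k) * of_nat (n choose Suc k) = (of_nat n - of_nat k) * (of_nat (n choose k) :: rat)"
proof (cases "k \<le> n")
  case True
  have "Suc k * (n choose Suc k) = (n - k) * (n choose k)"
    by (metis binomial_absorb_comp binomial_absorption mult.commute)
  then show ?thesis using True by (metis of_nat_diff of_nat_mult)
qed (simp add: binomial_eq_0)

lemma of_nat_binomial_add_Suc:
  "of_nat (Suc k) * of_nat (Suc (n + k) choose Suc k) =
     (of_nat n + of_nat k + 1) * (of_nat ((n + k) choose k) :: rat)"
proof -
  have "Suc k * (Suc (n + k) choose Suc k) = Suc (n + k) * ((n + k) choose k)"
    by (metis Suc_times_binomial_eq mult.commute)
  then have "(of_nat (Suc k * (Suc (n + k) choose Suc k)) :: rat) = of_nat (Suc (n + k) * ((n + k) choose k))"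
    by (rule arg_cong)
  then show ?thesis
    by (simp only: of_nat_mult of_nat_Suc of_nat_add add.assoc add.commute add.left_commute)
qed

lemma legendre_term_Suc:
  "legendre_term n (Suc k) =
     (of_nat k - of_nat n) * (of_nat n + of_nat k + 1) / (2 * (of_nat k + 1)\<^sup>2) * legendre_term n k"
proof -
  have "(of_nat (Suc k))\<^sup>2 * legendre_term n (Suc k) =
      (of_nat (Suc k) * of_nat (n choose Suc k)) * (of_nat (Suc k) * of_nat (Suc (n + k) choose Suc k))
        * (-1/2) ^ Suc k"
    by (simp only: legendre_term_def add_Suc_right power2_eq_square ac_simps)
  also have "\<dots> = (of_nat n - of_nat k) * (of_nat n + of_nat k + 1) * (-1/2) * legendre_term n k"
    unfolding of_nat_binomial_Suc[of k n] of_nat_binomial_add_Suc by (simp add: legendre_term_def)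
  finally show ?thesis
    by (simp add: field_simps)
qed

lemma legendre_aux_Suc:
  assumes "n > 0"
  shows "(of_nat k + 1)\<^sup>2 * legendre_aux n (Suc k) =
     (of_nat k - of_nat n) * (of_nat n + of_nat k) / 2 * legendre_aux n k"
proof -
  obtain m where m: "n = Suc m" using assms gr0_implies_Suc by blast
  have "(of_nat (Suc k))\<^sup>2 * legendre_aux n (Suc k) =
      (of_nat (Suc k) * of_nat (n choose Suc k)) * (of_nat (Suc k) * of_nat (Suc (m + k) choose Suc k))
        * (-1/2) ^ Suc k"
    by (simp only: legendre_aux_def m power2_eq_square ac_simps add_Suc add_Suc_right diff_Suc_1)
  also have "\<dots> = (of_nat n - of_nat k) * (of_nat n + of_nat k) * (-1/2) * legendre_aux n k"
    unfolding of_nat_binomial_Suc[of k n] of_nat_binomial_add_Suc by (simp add: legendre_aux_def m)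
  finally show ?thesis
    by (simp add: field_simps)
qed

text \<open>Both recurrences at \<open>0\<close>, namely \<open>n P\<^sub>n = -P'\<^sub>n\<^sub>-\<^sub>1\<close> and
  \<open>P'\<^sub>n = n P\<^sub>n\<^sub>-\<^sub>1\<close>, reduce via \<open>legendre_aux\<close> to the same sum, which telescopes.\<close>

lemma legendre_term_conv_aux:
  assumes "n > 0"
  shows "of_nat n * legendre_term n k = (of_nat n + of_nat k) * legendre_aux n k"
proof -
  obtain m where m: "n = Suc m" using assms gr0_implies_Suc by blast
  have "Suc m * (Suc (m + k) choose k) = Suc (m + k) * ((m + k) choose k)"
    using binomial_absorb_comp[of "Suc (m + k)" k] by simp
  then have "(of_nat (Suc m * (Suc (m + k) choose k)) :: rat) = of_nat (Suc (m + k) * ((m + k) choose k))"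
    by (rule arg_cong)
  then show ?thesis
    by (simp add: legendre_term_def legendre_aux_def m mult.left_commute mult.assoc)
       (simp add: algebra_simps)
qed

lemma legendre_term_pred_conv_aux:
  assumes "n > 0"
  shows "of_nat n * legendre_term (n - 1) k = (of_nat n - of_nat k) * legendre_aux n k"
proof -
  obtain m where m: "n = Suc m" using assms gr0_implies_Suc by blast
  have "(of_nat (Suc m) - of_nat k) * (of_nat (Suc m choose k) :: rat) = of_nat (Suc m) * of_nat (m choose k)"
  proof (cases "k \<le> Suc m")
    case True
    have "(Suc m - k) * (Suc m choose k) = Suc m * (m choose k)"
      using binomial_absorb_comp[of "Suc m" k] by simp
    then show ?thesis using True by (metis of_nat_diff of_nat_mult)
  qed (simp add: binomial_eq_0)
  then show ?thesis
    by (simp only: legendre_term_def legendre_aux_def m diff_Suc_1 add_Suc mult.assoc[symmetric])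
qed

lemma sum_legendre_aux:
  assumes "n > 0"
  shows "(\<Sum>k\<le>n. (of_nat n ^ 2 + of_nat k ^ 2) * legendre_aux n k) = 0"
proof -
  \<comment> \<open>A discrete antiderivative of the summand, by \<open>legendre_aux_Suc\<close>. It
    vanishes at \<open>0\<close> through the factor \<open>k ^ 2\<close> and at \<open>n + 1\<close>
    because \<open>n choose (n + 1)\<close> is zero.\<close>
  define G where "G k = -2 * of_nat k ^ 2 * legendre_aux n k" for k
  have "(of_nat n ^ 2 + of_nat k ^ 2) * legendre_aux n k = G (Suc k) - G k" for k
    using legendre_aux_Suc[OF assms, of k] by (simp add: G_def algebra_simps power2_eq_square)
  then have "(\<Sum>k\<le>n. (of_nat n ^ 2 + of_nat k ^ 2) * legendre_aux n k) = G (Suc n) - G 0"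
    by (simp only: sum_lessThan_telescope flip: lessThan_Suc_atMost)
  also have "\<dots> = 0" by (simp add: G_def legendre_aux_def)
  finally show ?thesis .
qed

text \<open>Brings the sums for degrees \<open>n - 1\<close> and \<open>n\<close> to the same range;
  the added term at \<open>k = n\<close> contains the binomial coefficient of \<open>n - 1\<close>
  over \<open>n\<close>, which is zero.\<close>

lemma sum_legendre_term_pred:
  assumes "n > 0"
  shows "(\<Sum>k\<le>n. f k * legendre_term (n - 1) k) = (\<Sum>k\<le>n - 1. f k * legendre_term (n - 1) k)"
  by (rule sum.mono_neutral_right) (use assms in \<open>auto simp: legendre_term_def binomial_eq_0\<close>)

lemma legendre_0_rec:
  assumes "n > 0"
  shows "of_nat n * legendre_0 n = legendre_0' (n - 1)"
proof -
  have n0: "of_nat n \<noteq> (0 :: rat)" using assms by simp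
  \<comment> \<open>The extra factor \<open>n\<close> lets both conversions to
    \<open>legendre_aux\<close> apply; the coefficient becomes
    \<open>n * (n + k) - k * (n - k) = n ^ 2 + k ^ 2\<close>.\<close>
  have "of_nat n * (of_nat n * legendre_0 n - legendre_0' (n - 1)) =
      (\<Sum>k\<le>n. of_nat n * (of_nat n * legendre_term n k) - of_nat k * (of_nat n * legendre_term (n - 1) k))"
    unfolding legendre_0_def legendre_0'_def sum_legendre_term_pred[OF assms, of of_nat, symmetric]
    by (simp add: sum_subtractf sum_distrib_left algebra_simps)
  also have "\<dots> = (\<Sum>k\<le>n. (of_nat n ^ 2 + of_nat k ^ 2) * legendre_aux n k)"
    unfolding legendre_term_conv_aux[OF assms] legendre_term_pred_conv_aux[OF assms]
    by (intro sum.cong) (auto simp: algebra_simps power2_eq_square)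
  also have "\<dots> = 0" by (rule sum_legendre_aux[OF assms])
  finally show ?thesis using n0 by simp
qed

lemma legendre_0'_rec:
  assumes "n > 0"
  shows "legendre_0' n = - of_nat n * legendre_0 (n - 1)"
proof -
  have n0: "of_nat n \<noteq> (0 :: rat)" using assms by simp
  \<comment> \<open>Here the coefficient is \<open>k * (n + k) + n * (n - k)\<close>, again
    \<open>n ^ 2 + k ^ 2\<close>.\<close>
  have "of_nat n * (legendre_0' n + of_nat n * legendre_0 (n - 1)) =
      (\<Sum>k\<le>n. of_nat k * (of_nat n * legendre_term n k) + of_nat n * (of_nat n * legendre_term (n - 1) k))"
    unfolding legendre_0_def legendre_0'_def
      sum_legendre_term_pred[OF assms, of "\<lambda>_. 1", unfolded mult_1, symmetric]
    by (simp add: sum.distrib sum_distrib_left algebra_simps)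
  also have "\<dots> = (\<Sum>k\<le>n. (of_nat n ^ 2 + of_nat k ^ 2) * legendre_aux n k)"
    unfolding legendre_term_conv_aux[OF assms] legendre_term_pred_conv_aux[OF assms]
    by (intro sum.cong) (auto simp: algebra_simps power2_eq_square)
  also have "\<dots> = 0" by (rule sum_legendre_aux[OF assms])
  finally show ?thesis using n0 by (simp add: eq_neg_iff_add_eq_0)
qed

text \<open>Polymorphic because the recursion serves both exact values over the rationals and
  congruences over the integers.\<close>

lemma of_nat_central_binomial_Suc:
  "of_nat (Suc m) * of_nat (2 * Suc m choose Suc m) = 2 * (2 * of_nat m + 1) * (of_nat (2 * m choose m) :: 'a :: comm_ring_1)"
proof -
  have double_Suc: "2 * Suc m = Suc (Suc (2 * m))" by simp
  have "Suc m * (2 * Suc m choose Suc m) = Suc (Suc (2 * m)) * (Suc (2 * m) choose m)"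
    unfolding double_Suc Suc_times_binomial_eq by (rule mult.commute)
  also have "\<dots> = 2 * (Suc m * (Suc (2 * m) choose m))"
    by (simp del: binomial_Suc_Suc)
  also have "Suc m * (Suc (2 * m) choose m) = Suc (2 * m) * (2 * m choose m)"
    using binomial_absorb_comp[of "Suc (2 * m)" m] by (simp add: Suc_diff_le)
  finally have "(of_nat (Suc m * (2 * Suc m choose Suc m)) :: 'a) = of_nat (2 * (Suc (2 * m) * (2 * m choose m)))"
    by (rule arg_cong)
  then show ?thesis
    by (simp only: of_nat_mult of_nat_Suc of_nat_numeral mult.assoc add.commute)
qed

text \<open>The two recurrences combine to \<open>(2m + 2) P(2m + 2) = -(2m + 1) P(2m)\<close> at
  zero, which is the recursion of the central binomial coefficients scaled by
  \<open>-1/4\<close>.\<close>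

lemma legendre_0_even: "legendre_0 (2 * m) = (-1/4) ^ m * of_nat (2 * m choose m)"
proof (induction m)
  case 0
  then show ?case by (simp add: legendre_0_def legendre_term_def)
next
  case (Suc m)
  have "of_nat (2 * Suc m) * legendre_0 (2 * Suc m) = - of_nat (2 * m + 1) * legendre_0 (2 * m)"
    using legendre_0_rec[of "2 * Suc m"] legendre_0'_rec[of "2 * m + 1"] by simp
  also have "\<dots> = (-1/4) ^ m * (- (2 * of_nat m + 1) * of_nat (2 * m choose m))"
    unfolding Suc by (simp add: algebra_simps)
  also have "\<dots> = (-1/4) ^ m * (- (of_nat (Suc m) * of_nat (2 * Suc m choose Suc m)) / 2)"
    unfolding of_nat_central_binomial_Suc by (simp add: algebra_simps)
  also have "\<dots> = of_nat (2 * Suc m) * ((-1/4) ^ Suc m * of_nat (2 * Suc m choose Suc m))"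
    by simp
  finally show ?case by (metis mult_left_cancel of_nat_eq_0_iff mult_eq_0_iff nat.simps(3) zero_neq_numeral)
qed

lemma legendre_0_odd: "legendre_0 (2 * m + 1) = 0"
proof (induction m)
  case 0
  then show ?case using legendre_0_rec[of 1] by (simp add: legendre_0'_def)
next
  case (Suc m)
  have "of_nat (2 * Suc m + 1) * legendre_0 (2 * Suc m + 1) = - of_nat (2 * Suc m) * legendre_0 (2 * m + 1)"
    using legendre_0_rec[of "2 * Suc m + 1"] legendre_0'_rec[of "2 * Suc m"] by simp
  then show ?case using Suc by (metis mult_eq_0_iff of_nat_eq_0_iff add_is_0 one_neq_zero)
qed

lemma legendre_0'_even: "legendre_0' (2 * m) = 0"
  using legendre_0'_rec[of "2 * m"] legendre_0_odd[of "m - 1"]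
  by (cases m) (auto simp: legendre_0'_def)

lemma legendre_0'_odd: "legendre_0' (2 * m + 1) = - of_nat (2 * m + 1) * (-1/4) ^ m * of_nat (2 * m choose m)"
  using legendre_0'_rec[of "2 * m + 1"] by (simp add: legendre_0_even)

subsection \<open>Reduction of the sums modulo p\<close>

definition sum_term :: "nat \<Rightarrow> rat" where
  "sum_term k = of_nat (fact (3 * k)) / (54 ^ k * of_nat (fact k) ^ 3)"

lemma sum_term_Suc:
  "sum_term (Suc k) = (3 * of_nat k + 1) * (3 * of_nat k + 2) / (18 * (of_nat k + 1)\<^sup>2) * sum_term k"
proof -
  define x :: rat where "x = of_nat k + 1"
  have "x \<noteq> 0"
    unfolding x_def by (metis of_nat_Suc of_nat_eq_0_iff nat.simps(3) add.commute)
  have "3 * Suc k = Suc (Suc (Suc (3 * k)))" by simp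
  then have "(fact (3 * Suc k) :: rat) = 3 * x * ((3 * of_nat k + 1) * (3 * of_nat k + 2)) * fact (3 * k)"
    by (simp only: fact_Suc x_def) (simp add: algebra_simps)
  moreover have "(fact (Suc k) :: rat) = x * fact k"
    by (simp add: x_def)
  moreover have "3 * x * c * F / (54 * w * (x * f) ^ 3) = c / (18 * x\<^sup>2) * (F / (w * f ^ 3))" for c F w f
    using \<open>x \<noteq> 0\<close> by (simp add: power_mult_distrib power2_eq_square power3_eq_cube mult_ac)
  ultimately show ?thesis
    unfolding sum_term_def of_nat_fact x_def[symmetric] by (simp only: power_Suc)
qed

lemma coprime_int_less:
  assumes "prime p" "0 < k" "k < p"
  shows "coprime (int k) (int p)"
  using assms by (metis coprime_commute coprime_int_iff nat_dvd_not_less prime_imp_coprime)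

lemma coprime_2_3_powers:
  assumes "prime p" "p > 3"
  shows "coprime (2 ^ a * 3 ^ b) (int p)"
proof -
  have "coprime (int 2) (int p)" "coprime (int 3) (int p)"
    by (rule coprime_int_less[OF assms(1)]; use assms(2) in simp)+
  then show ?thesis
    by (simp only: coprime_mult_left_iff coprime_power_left_iff of_nat_numeral) simp
qed

text \<open>Up to the common denominator \<open>18 * (k + 1)^2\<close>, the two term ratios differ
  by \<open>(3 * n + 1) * (3 * n + 2)\<close>, and \<open>p\<close> is one of these factors. Since
  \<open>k + 1 <= n < p\<close>, the denominators stay prime to \<open>p\<close>.\<close>

lemma sum_term_cong:
  assumes p: "prime p" "p > 5" and n: "p = 3 * n + 1 \<or> p = 3 * n + 2" and "k \<le> n"
  shows "rat_cong (sum_term k) (legendre_term n k) (int p)"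
  using \<open>k \<le> n\<close>
proof (induction k)
  case 0
  then show ?case by (simp add: sum_term_def legendre_term_def rat_cong_refl)
next
  case (Suc k)
  have p': "prime (int p)" using p by simp
  have cop: "coprime (18 * (int k + 1)\<^sup>2) (int p)"
  proof -
    have "coprime (int (Suc k)) (int p)"
      by (rule coprime_int_less[OF p(1)]; use n Suc.prems in auto)
    moreover have "coprime 18 (int p)"
      using coprime_2_3_powers[of p 1 2] p by simp
    ultimately show ?thesis by (simp add: add.commute)
  qed
  let ?t = "of_int ((3 * int k + 1) * (3 * int k + 2)) / of_int (18 * (int k + 1)\<^sup>2) * legendre_term n k"
  have "rat_cong (sum_term (Suc k)) ?t (int p)"
    using rat_cong_mult_left[OF p' Suc.IH cop, of "(3 * int k + 1) * (3 * int k + 2)"] Suc.prems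
    by (simp add: sum_term_Suc)
  moreover have "rat_cong ?t (legendre_term n (Suc k)) (int p)"
  proof (rule rat_congI[OF p'])
    let ?F = "int (n choose k) * int ((n + k) choose k) * (-1) ^ k"
    have "coprime (2 ^ k) (int p)"
      using coprime_2_3_powers[of p k 0] p by simp
    then show "coprime (18 * (int k + 1)\<^sup>2 * 2 ^ k) (int p)"
      using cop by (simp only: coprime_mult_left_iff)
    have "int p = 3 * int n + 1 \<or> int p = 3 * int n + 2"
      using n by auto
    then show "int p dvd (3 * int n + 1) * (3 * int n + 2) * ?F"
      by (metis dvd_mult2 dvd_triv_left dvd_triv_right)
    have F: "legendre_term n k = of_int ?F / 2 ^ k"
      unfolding legendre_term_def power_divide by simp
    have "a / (18 * y) * t - b / (2 * y) * t = (a - 9 * b) / (18 * y) * t" for a b t y :: rat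
      by (cases "y = 0") (simp_all add: field_simps)
    then have "?t - legendre_term n (Suc k) =
        ((3 * of_nat k + 1) * (3 * of_nat k + 2) - 9 * ((of_nat k - of_nat n) * (of_nat n + of_nat k + 1)))
          / (18 * (of_nat k + 1)\<^sup>2) * legendre_term n k"
      unfolding legendre_term_Suc by simp
    also have "(3 * of_nat k + 1) * (3 * of_nat k + 2) - 9 * ((of_nat k - of_nat n) * (of_nat n + of_nat k + 1))
        = (3 * of_nat n + 1) * (3 * of_nat n + 2 :: rat)"
      by (simp add: algebra_simps)
    finally show "?t - legendre_term n (Suc k) = of_int ((3 * int n + 1) * (3 * int n + 2) * ?F)
          / of_int (18 * (int k + 1)\<^sup>2 * 2 ^ k)"
      unfolding F by simp
  qed
  ultimately show ?case by (rule rat_cong_trans[OF p'])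
qed

lemma sum_term_sum_cong:
  assumes "prime p" "p > 5" "p = 3 * n + 1 \<or> p = 3 * n + 2"
  shows "rat_cong (\<Sum>k = 0..n. sum_term k) (legendre_0 n) (int p)"
    and "rat_cong (\<Sum>k = 0..n. of_nat k * sum_term k) (legendre_0' n) (int p)"
proof -
  show "rat_cong (\<Sum>k = 0..n. sum_term k) (legendre_0 n) (int p)"
    unfolding legendre_0_def atMost_atLeast0
    by (rule rat_cong_sum) (use assms sum_term_cong in auto)
  show "rat_cong (\<Sum>k = 0..n. of_nat k * sum_term k) (legendre_0' n) (int p)"
    unfolding legendre_0'_def atMost_atLeast0
  proof (rule rat_cong_sum)
    fix k assume "k \<in> {0..n}"
    then show "rat_cong (of_nat k * sum_term k) (of_nat k * legendre_term n k) (int p)"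
      using rat_cong_mult_left[of "int p" "sum_term k" "legendre_term n k" 1 "int k"]
        sum_term_cong[OF assms, of k] assms(1) by simp
  qed (use assms in simp)
qed

text \<open>Modulo \<open>p\<close> the number \<open>N\<close> is \<open>-1/2\<close>, and the
  generalised binomial coefficient of \<open>-1/2\<close> over \<open>j\<close> is
  \<open>(-1/4) ^ j\<close> times the central one. The induction compares successive ratios.\<close>

lemma central_binomial_cong:
  assumes "prime p" "p = 2 * N + 1" "j \<le> N"
  shows "[(-4) ^ j * int (N choose j) = int (2 * j choose j)] (mod int p)"
  using assms(3)
proof (induction j)
  case (Suc j)
  have N: "int (Suc j) * int (N choose Suc j) = (int N - int j) * int (N choose j)"
  proof -
    have "Suc j * (N choose Suc j) = (N - j) * (N choose j)"
      by (metis binomial_absorb_comp binomial_absorption mult.commute)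
    then show ?thesis using Suc.prems by (metis Suc_leD of_nat_diff of_nat_mult)
  qed
  have "int (Suc j) * ((-4) ^ Suc j * int (N choose Suc j)) = -4 * (-4) ^ j * (int (Suc j) * int (N choose Suc j))"
    by simp
  also have "\<dots> = (-4 * (int N - int j)) * ((-4) ^ j * int (N choose j))"
    unfolding N by (simp add: algebra_simps)
  also have "[\<dots> = (2 * (2 * int j + 1)) * int (2 * j choose j)] (mod int p)"
  proof (rule cong_mult)
    \<comment> \<open>The difference of the two sides is \<open>-4 * N - 2 = -2 * p\<close>.\<close>
    show "[-4 * (int N - int j) = 2 * (2 * int j + 1)] (mod int p)"
      unfolding cong_iff_dvd_diff by (rule dvdI[of _ _ "-2"]) (simp add: assms(2))
    show "[(-4) ^ j * int (N choose j) = int (2 * j choose j)] (mod int p)"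
      using Suc by simp
  qed
  also have "(2 * (2 * int j + 1)) * int (2 * j choose j) = int (Suc j) * int (2 * Suc j choose Suc j)"
    by (rule of_nat_central_binomial_Suc[symmetric])
  finally have "[int (Suc j) * ((-4) ^ Suc j * int (N choose Suc j)) = int (Suc j) * int (2 * Suc j choose Suc j)] (mod int p)" .
  moreover have "coprime (int (Suc j)) (int p)"
    by (rule coprime_int_less) (use assms Suc.prems in auto)
  ultimately show ?case using cong_mult_lcancel by blast
qed simp

text \<open>This is \<open>central_binomial_cong\<close> with \<open>N = 3 * m\<close> and
  \<open>j = m\<close>, divided by \<open>(-4) ^ m\<close>.\<close>

lemma legendre_0_cong:
  assumes "prime p" "p = 6 * m + 1"
  shows "rat_cong (legendre_0 (2 * m)) (of_nat (3 * m choose m)) (int p)"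
proof -
  have p': "prime (int p)" using assms(1) by simp
  have "p > 3"
    using assms by (cases m) auto
  then have "coprime 4 (int p)"
    using coprime_2_3_powers[of p 2 0] assms(1) by simp
  then have "coprime (-4) (int p)"
    by (metis coprime_minus_left_iff)
  then have c4: "coprime ((-4) ^ m) (int p)"
    by (rule coprime_power_left_iff[THEN iffD2, OF disjI1])
  have "rat_cong (of_int 1 / of_int ((-4) ^ m) * of_int (int (2 * m choose m)))
      (of_int 1 / of_int ((-4) ^ m) * of_int ((-4) ^ m * int (3 * m choose m))) (int p)"
    by (intro rat_cong_mult_left rat_cong_of_int p' c4 cong_sym[OF central_binomial_cong])
       (use assms in auto)
  moreover have "legendre_0 (2 * m) = of_int 1 / of_int ((-4) ^ m) * of_int (int (2 * m choose m))"
    unfolding legendre_0_even by (simp add: field_simps flip: power_mult_distrib)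
  ultimately show ?thesis by simp
qed

text \<open>The exact value on the left is \<open>6 * (m + 1)\<close> times the right-hand side, and
  \<open>6 * (m + 1) = p + 1\<close> is 1 modulo \<open>p\<close>.\<close>

lemma legendre_0'_cong:
  assumes "prime p" "p = 6 * m + 5"
  shows "rat_cong (legendre_0' (2 * m + 1))
    (1/3 * (-1) ^ (m + 1) * inverse (2 ^ (2 * m + 2)) * of_nat ((2 * m + 2) choose (m + 1))) (int p)"
proof (rule rat_congI)
  let ?C = "int (2 * m choose m)"
  show "prime (int p)" using assms(1) by simp
  have "coprime (int (Suc m)) (int p)"
    by (rule coprime_int_less; use assms in simp)
  moreover have "coprime (2 ^ (2 * m + 1) * 3 ^ 1) (int p)"
    by (rule coprime_2_3_powers) (use assms in simp_all)
  then have "coprime (6 * 4 ^ m) (int p)"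
    by (simp add: power_mult)
  ultimately show "coprime (6 * 4 ^ m * (int m + 1)) (int p)"
    by (simp only: coprime_mult_left_iff of_nat_Suc add.commute)
  show "int p dvd (-1) ^ (m + 1) * (2 * int m + 1) * ?C * int p" by simp
  have m0: "(of_nat m + 1 :: rat) \<noteq> 0"
    by (metis of_nat_Suc of_nat_eq_0_iff nat.simps(3) add.commute)
  have C: "of_nat ((2 * m + 2) choose (m + 1)) = 2 * (2 * of_nat m + 1) * (of_nat (2 * m choose m) :: rat) / (of_nat m + 1)"
  proof -
    have double_Suc: "2 * (m + 1) = 2 * m + 2" by simp
    have "(of_nat m + 1) * of_nat ((2 * m + 2) choose (m + 1)) = 2 * (2 * of_nat m + 1) * (of_nat (2 * m choose m) :: rat)"
      using of_nat_central_binomial_Suc[of m, where ?'a = rat]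
      by (simp only: double_Suc Suc_eq_plus1 of_nat_add of_nat_1)
    then show ?thesis
      by (intro eq_divide_imp[OF m0]) (simp only: mult.commute)
  qed
  have pow4: "(2 :: rat) ^ (2 * m + 2) = 4 * 4 ^ m"
    by (simp add: power_mult)
  have 1: "1/3 * (-1) ^ (m + 1) * inverse (2 ^ (2 * m + 2)) * of_nat ((2 * m + 2) choose (m + 1)) =
      (-1) ^ (m + 1) * (2 * of_nat m + 1) * (of_nat (2 * m choose m) :: rat) / (6 * (of_nat m + 1) * 4 ^ m)"
    unfolding C pow4 using m0 by (simp add: divide_simps) (simp add: algebra_simps)
  have 2: "legendre_0' (2 * m + 1) = (-1) ^ (m + 1) * (2 * of_nat m + 1) * of_nat (2 * m choose m) / 4 ^ m"
    unfolding legendre_0'_odd power_divide by (simp add: field_simps)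
  show "legendre_0' (2 * m + 1) - 1/3 * (-1) ^ (m + 1) * inverse (2 ^ (2 * m + 2)) * of_nat ((2 * m + 2) choose (m + 1))
      = of_int ((-1) ^ (m + 1) * (2 * int m + 1) * ?C * int p) / of_int (6 * 4 ^ m * (int m + 1))"
    unfolding 1 2 using m0 by (simp add: assms(2) divide_simps) (simp add: algebra_simps)
qed

subsection \<open>Quadratic character sums\<close>

lemma Legendre_mod [simp]: "Legendre (a mod p) p = Legendre a p"
  by (simp add: Legendre_def QuadRes_def cong_def)

lemma Legendre_cong: "[a = b] (mod p) \<Longrightarrow> Legendre a p = Legendre b p"
  by (metis Legendre_mod cong_def)

lemma Legendre_values: "Legendre a p \<in> {-1, 0, 1}"
  by (simp add: Legendre_def)

lemma Legendre_eq_0_iff: "Legendre a p = 0 \<longleftrightarrow> [a = 0] (mod p)"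
  by (simp add: Legendre_def)

lemma odd_Legendre_iff: "odd (Legendre a p) \<longleftrightarrow> \<not> [a = 0] (mod p)"
  by (simp add: Legendre_def)

lemma Legendre_power2: "\<not> [a = 0] (mod p) \<Longrightarrow> Legendre a p ^ 2 = 1"
  by (simp add: Legendre_def)

text \<open>Euler's criterion makes both sides congruent modulo \<open>p\<close>; as they differ by
  at most \<open>2 < p\<close>, they are equal.\<close>

lemma Legendre_mult:
  fixes p :: nat
  assumes "prime p" "2 < p"
  shows "Legendre (a * b) p = Legendre a p * Legendre b p"
proof -
  let ?e = "(p - 1) div 2"
  have "[Legendre (a * b) p = (a * b) ^ ?e] (mod p)"
    by (rule euler_criterion[OF assms])
  moreover have "[Legendre a p * Legendre b p = a ^ ?e * b ^ ?e] (mod p)"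
    by (intro cong_mult euler_criterion assms)
  ultimately have "[Legendre (a * b) p = Legendre a p * Legendre b p] (mod p)"
    by (metis power_mult_distrib cong_sym cong_trans)
  then have "int p dvd Legendre (a * b) p - Legendre a p * Legendre b p"
    by (simp add: cong_iff_dvd_diff)
  moreover have "\<bar>Legendre (a * b) p - Legendre a p * Legendre b p\<bar> \<le> 2"
    using Legendre_values[of "a * b" p] Legendre_values[of a p] Legendre_values[of b p] by auto
  ultimately show ?thesis
    using assms(2) dvd_imp_le_int[of "Legendre (a * b) p - Legendre a p * Legendre b p" "int p"] by auto
qed

section \<open>Sums of periodic functions over residues\<close>

lemma sum_residues_shift:
  fixes f :: "int \<Rightarrow> 'a :: comm_monoid_add"
  assumes "n > 0" and "\<And>x. f (x mod n) = f x"
  shows "(\<Sum>x\<in>{0..<n}. f (x + c)) = (\<Sum>x\<in>{0..<n}. f x)"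
  by (rule sum.reindex_bij_witness[where i = "\<lambda>x. (x - c) mod n" and j = "\<lambda>x. (x + c) mod n"])
     (use assms in \<open>auto simp: mod_simps\<close>)

lemma sum_residues_scale:
  fixes f :: "int \<Rightarrow> 'a :: comm_monoid_add"
  assumes "n > 0" and "coprime c n" and per: "\<And>x. f (x mod n) = f x"
  shows "(\<Sum>x\<in>{0..<n}. f (c * x)) = (\<Sum>x\<in>{0..<n}. f x)"
proof -
  obtain d where d: "[c * d = 1] (mod n)"
    using assms(2) cong_solve_coprime_int by blast
  have inv: "(c * (d * x)) mod n = x mod n" for x
    using cong_mult[OF d cong_refl[of x n]] by (simp add: cong_def mult.assoc)
  then have inv': "(d * (c * x)) mod n = x mod n" for x
    by (simp add: mult.left_commute)
  show ?thesis
    by (rule sum.reindex_bij_witness[where i = "\<lambda>x. (d * x) mod n" and j = "\<lambda>x. (c * x) mod n"])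
       (use assms inv inv' in \<open>auto simp: mod_simps\<close>)
qed

lemma sum_lessThan_mod:
  fixes f :: "nat \<Rightarrow> int"
  shows "(\<Sum>j<k * n. f (j mod n)) = int k * (\<Sum>j<n. f j)"
proof -
  have "(\<Sum>j<k * n. f (j mod n)) = (\<Sum>i<k. \<Sum>j\<in>{i*n..<i*n+n}. f (j mod n))"
    by (rule sum.nat_group[symmetric])
  also have "\<dots> = (\<Sum>i<k. \<Sum>j<n. f j)"
  proof (rule sum.cong[OF refl])
    fix i
    show "(\<Sum>j\<in>{i*n..<i*n+n}. f (j mod n)) = (\<Sum>j<n. f j)"
      by (rule sum.reindex_bij_witness[where i = "\<lambda>j. i * n + j" and j = "\<lambda>j. j - i * n"])
         (auto dest!: le_Suc_ex)
  qed
  finally show ?thesis by simp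
qed

section \<open>Quadratic character sums through powers of a primitive root\<close>

locale odd_prime_primroot =
  fixes p g :: nat
  assumes prime_p: "prime p" and p_gt_2: "2 < p" and primroot: "residue_primroot p g"
begin

abbreviation chi :: "int \<Rightarrow> int" where "chi a \<equiv> Legendre a (int p)"
abbreviation R :: "int set" where "R \<equiv> {0..<int p}"

lemmas chi_mult = Legendre_mult[OF prime_p p_gt_2]

lemma chi_1 [simp]: "chi 1 = 1"
  using p_gt_2 by (auto simp: Legendre_def cong_def QuadRes_def intro: exI[of _ 1])

lemma chi_0 [simp]: "chi 0 = 0"
  by (simp add: Legendre_def)

lemma chi_power: "chi (a ^ k) = chi a ^ k"
  by (induction k) (auto simp: chi_mult)

lemma coprime_g: "coprime (int g) (int p)"
  using primroot by (simp add: residue_primroot_def coprime_commute)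

lemma ord_g: "ord p g = p - 1"
  using primroot prime_p by (simp add: residue_primroot_def totient_prime)

lemma power_g_cong_iff: "[int g ^ i = int g ^ j] (mod int p) \<longleftrightarrow> [i = j] (mod (p - 1))"
proof -
  have "[int g ^ i = int g ^ j] (mod int p) \<longleftrightarrow> [g ^ i = g ^ j] (mod p)"
    by (simp flip: of_nat_power add: cong_int_iff)
  then show ?thesis
    using order_divides_expdiff[of p g i j] coprime_g ord_g by (simp add: coprime_commute)
qed

lemma power_g_not_cong_0: "\<not> [int g ^ i = 0] (mod int p)"
proof
  assume "[int g ^ i = 0] (mod int p)"
  then have "p dvd g ^ i"
    by (simp add: cong_0_iff flip: of_nat_power)
  then have "p dvd g" by (rule prime_dvd_power[OF prime_p])
  then show False
    using coprime_g prime_p by (metis coprime_int_iff coprime_absorb_right not_prime_unit)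
qed

lemma sum_power_g:
  fixes f :: "int \<Rightarrow> int"
  assumes per: "\<And>x. f (x mod int p) = f x"
  shows "(\<Sum>x\<in>R. f x) = f 0 + (\<Sum>i<p - 1. f (int g ^ i))"
proof -
  have bij: "bij_betw (\<lambda>i. g ^ i mod p) {..<p - 1} {0<..<p}"
    using residue_primroot_is_generator[of p g] primroot p_gt_2 prime_p
    by (simp add: totient_prime totatives_prime)
  have "R = insert 0 (int ` {0<..<p})"
    using p_gt_2 by (auto simp: image_iff) (metis order_less_le zero_less_imp_eq_int greaterThanLessThan_iff of_nat_less_iff)
  then have "(\<Sum>x\<in>R. f x) = f 0 + (\<Sum>x\<in>int ` {0<..<p}. f x)"
    by (subst sum.insert[symmetric]) auto
  also have "(\<Sum>x\<in>int ` {0<..<p}. f x) = (\<Sum>x\<in>{0<..<p}. f (int x))"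
    by (subst sum.reindex) auto
  also have "\<dots> = (\<Sum>i<p - 1. f (int (g ^ i mod p)))"
    by (rule sum.reindex_bij_betw[OF bij, symmetric])
  also have "\<dots> = (\<Sum>i<p - 1. f (int g ^ i))"
    by (simp add: of_nat_mod per)
  finally show ?thesis .
qed

lemma euler_g: "[chi (int g) = int g ^ ((p - 1) div 2)] (mod int p)"
  by (rule euler_criterion[OF prime_p p_gt_2])

text \<open>By Euler's criterion the value 1 would force \<open>g ^ ((p - 1) div 2)\<close> to be 1,
  although that exponent is positive and below the order of \<open>g\<close>.\<close>

lemma chi_g: "chi (int g) = -1"
proof -
  have "odd p" using prime_p p_gt_2 prime_odd_nat by blast
  then have "0 < (p - 1) div 2" "(p - 1) div 2 < p - 1" using p_gt_2 by auto
  then have "\<not> [int g ^ ((p - 1) div 2) = int g ^ 0] (mod int p)"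
    unfolding power_g_cong_iff by (simp add: cong_def)
  then have "chi (int g) \<noteq> 1"
    using euler_g by (metis cong_sym power_0)
  moreover have "chi (int g) \<noteq> 0"
    using power_g_not_cong_0[of 1] by (simp add: Legendre_eq_0_iff)
  ultimately show ?thesis using Legendre_values[of "int g" "int p"] by auto
qed

lemma sum_R_scale_g:
  fixes f :: "int \<Rightarrow> int"
  assumes "\<And>x. f (x mod int p) = f x"
  shows "(\<Sum>x\<in>R. f (int g * x)) = (\<Sum>x\<in>R. f x)"
  using p_gt_2 by (intro sum_residues_scale coprime_g assms) auto

lemma mod_cong_self: "[x mod int p = x] (mod int p)"
  by (simp add: cong_def)

lemma chi_poly_mod:
  "chi ((x mod int p) ^ k + a) = chi (x ^ k + a)"
  "chi (x mod int p * (x mod int p + a)) = chi (x * (x + a))"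
  "chi ((x mod int p + b) * (x mod int p + a)) = chi ((x + b) * (x + a))"
  by (intro Legendre_cong cong_add cong_mult cong_pow cong_refl mod_cong_self)+

lemma sum_chi: "(\<Sum>x\<in>R. chi x) = 0"
proof -
  have "(\<Sum>x\<in>R. chi x) = (\<Sum>x\<in>R. chi (int g * x))"
    by (rule sum_R_scale_g[symmetric]) simp
  also have "\<dots> = - (\<Sum>x\<in>R. chi x)" by (simp add: chi_mult chi_g sum_negf)
  finally show ?thesis by simp
qed

text \<open>Substituting \<open>g * x\<close> for \<open>x\<close> shows that the sum takes one
  common value at all nonzero \<open>w\<close>, since \<open>chi g\<close> enters squared. Its value
  at \<open>w = 0\<close> is \<open>p - 1\<close>, and summing over all \<open>w\<close> in the
  other order gives 0, so the common value is \<open>-1\<close>.\<close>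

lemma sum_chi_mult_shift:
  "(\<Sum>x\<in>R. chi (x * (x + w))) = (if [w = 0] (mod int p) then int p - 1 else -1)"
proof -
  define J where "J w = (\<Sum>x\<in>R. chi (x * (x + w)))" for w
  have J_mod: "J (w mod int p) = J w" for w
    unfolding J_def by (intro sum.cong refl Legendre_cong cong_add cong_mult cong_refl mod_cong_self)
  have J0: "J 0 = int p - 1"
  proof -
    have "J 0 = (\<Sum>x\<in>R. chi x ^ 2)"
      by (simp add: J_def chi_mult power2_eq_square)
    also have "\<dots> = (\<Sum>i<p - 1. 1)"
      by (subst sum_power_g) (simp_all add: Legendre_power2 power_g_not_cong_0 Legendre_eq_0_iff)
    finally have "J 0 = (\<Sum>i<p - 1. 1)" .
    then show ?thesis using p_gt_2 by simp
  qed
  have J_g: "J (int g * w) = J w" for w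
  proof -
    have "J (int g * w) = (\<Sum>x\<in>R. chi ((int g * x) * (int g * x + int g * w)))"
      unfolding J_def by (rule sum_R_scale_g[symmetric]) (rule chi_poly_mod)
    also have "\<dots> = J w"
      unfolding J_def by (simp add: chi_mult chi_g flip: distrib_left)
    finally show ?thesis .
  qed
  have J_pow: "J (int g ^ i) = J 1" for i
    by (induction i) (auto simp: J_g)
  have "(\<Sum>w\<in>R. J w) = (\<Sum>x\<in>R. chi x * (\<Sum>w\<in>R. chi (w + x)))"
    unfolding J_def by (subst sum.swap) (simp add: chi_mult sum_distrib_left add.commute)
  also have "\<dots> = 0"
    using p_gt_2 by (subst sum_residues_shift) (auto simp: sum_chi)
  finally have "J 0 + (int p - 1) * J 1 = 0"
    using p_gt_2 by (subst (asm) sum_power_g) (auto simp: J_mod J_pow of_nat_diff)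
  then have "(int p - 1) * (1 + J 1) = 0" using J0 by (simp add: algebra_simps)
  then have J1: "J 1 = -1" using p_gt_2 by auto
  show ?thesis
  proof (cases "[w = 0] (mod int p)")
    case True
    then show ?thesis using J0 J_mod[of w] by (simp add: J_def[symmetric] cong_def)
  next
    case False
    have "\<exists>i. [w = int g ^ i] (mod int p)"
    proof (rule ccontr)
      assume *: "\<not> ?thesis"
      \<comment> \<open>Applying \<open>sum_power_g\<close> to the indicator of the class of
        \<open>w\<close> shows that the powers of \<open>g\<close> reach \<open>w\<close>: otherwise
        its total would be 0, though \<open>w mod p\<close> contributes 1.\<close>
      define f where "f x = (if [w = x] (mod int p) then 1 else 0 :: int)" for x
      have "(\<Sum>x\<in>R. f x) = f 0 + (\<Sum>i<p - 1. f (int g ^ i))"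
        by (rule sum_power_g) (simp add: f_def cong_def)
      also have "\<dots> = 0" using * False by (auto simp: f_def)
      finally have "(\<Sum>x\<in>R. f x) = 0" .
      moreover have "(\<Sum>x\<in>R. f x) \<ge> (\<Sum>x\<in>{w mod int p}. f x)"
        by (rule sum_mono2) (use p_gt_2 in \<open>auto simp: f_def\<close>)
      ultimately show False by (simp add: f_def)
    qed
    then obtain i where "[w = int g ^ i] (mod int p)" by blast
    then have "J w = J 1" using J_mod[of w] J_mod[of "int g ^ i"] J_pow by (simp add: cong_def)
    then show ?thesis using False J1 by (simp add: J_def)
  qed
qed

lemma sum_chi_mult:
  "(\<Sum>x\<in>R. chi ((x + a) * (x + b))) = (if [a = b] (mod int p) then int p else 0) - 1"
proof -
  have "(\<Sum>x\<in>R. chi ((x + a) * (x + b))) = (\<Sum>x\<in>R. chi ((x - a + a) * (x - a + b)))"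
    using sum_residues_shift[of "int p" "\<lambda>x. chi ((x + a) * (x + b))" "-a"] p_gt_2
    by (simp add: chi_poly_mod)
  also have "\<dots> = (\<Sum>x\<in>R. chi (x * (x + (b - a))))"
    by (simp add: algebra_simps)
  also have "[b - a = 0] (mod int p) \<longleftrightarrow> [a = b] (mod int p)"
    by (metis cong_diff_iff_cong_0 cong_sym_eq)
  then have "(\<Sum>x\<in>R. chi (x * (x + (b - a)))) = (if [a = b] (mod int p) then int p else 0) - 1"
    unfolding sum_chi_mult_shift by simp
  finally show ?thesis .
qed

end


subsection \<open>The cubic character sum and representations by the form with coefficients 1 and 3\<close>

locale cubic_char_sum = odd_prime_primroot +
  fixes m :: nat
  assumes p_eq: "p = 6 * m + 1"
begin

lemma m_pos: "m > 0"
  using p_eq p_gt_2 by (cases m) auto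

lemma p_minus_1: "p - 1 = 6 * m" "p - Suc 0 = 6 * m"
  using p_eq by simp_all

text \<open>Cubing a power of \<open>g\<close> triples its exponent, which counts modulo
  \<open>p - 1 = 6 * m\<close>; hence the cube sees the exponent only modulo
  \<open>2 * m\<close>.\<close>

lemma triple_cong_iff: "[i * 3 = j * 3] (mod (6 * m)) \<longleftrightarrow> i mod (2 * m) = j mod (2 * m)"
proof -
  have "6 * m = 2 * m * 3" by simp
  then show ?thesis by (simp only: cong_def flip: mult_mod_left) simp
qed

text \<open>\<open>p + S a\<close> is the number of solutions of \<open>y^2 = x^3 + a\<close> modulo
  \<open>p\<close>.\<close>

definition S :: "int \<Rightarrow> int" where
  "S a = (\<Sum>x\<in>R. chi (x ^ 3 + a))"

text \<open>\<open>S\<close> changes sign under \<open>a \<mapsto> g\<^sup>3 a\<close>; the factor \<open>\<chi>(a)\<close> compensates, so that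
  \<open>T i\<close> depends only on \<open>i mod 3\<close>.\<close>

definition T :: "nat \<Rightarrow> int" where
  "T i = chi (int g ^ i) * S (int g ^ i)"

lemma S_mod: "S (a mod int p) = S a"
  unfolding S_def by (intro sum.cong refl Legendre_cong cong_add cong_refl mod_cong_self)

lemma S_scale: "S (int g ^ 3 * a) = - S a"
proof -
  have "S (int g ^ 3 * a) = (\<Sum>x\<in>R. chi ((int g * x) ^ 3 + int g ^ 3 * a))"
    unfolding S_def by (rule sum_R_scale_g[symmetric]) (rule chi_poly_mod)
  also have "\<dots> = (\<Sum>x\<in>R. chi (int g ^ 3) * chi (x ^ 3 + a))"
    by (simp add: power_mult_distrib flip: chi_mult distrib_left)
  also have "\<dots> = - S a"
    by (simp add: S_def chi_power chi_g sum_negf)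
  finally show ?thesis .
qed

lemma T_add_3: "T (i + 3) = T i"
proof -
  have "int g ^ (i + 3) = int g ^ 3 * int g ^ i" by (simp add: power_add)
  then show ?thesis
    unfolding T_def by (simp only: S_scale chi_mult chi_power chi_g) simp
qed

lemma T_mod_3: "T (i mod 3) = T i"
proof (induction i rule: less_induct)
  case (less i)
  show ?case
  proof (cases "i < 3")
    case False
    then have "T ((i - 3) mod 3) = T (i - 3)" by (intro less) simp
    then show ?thesis using False T_add_3[of "i - 3"] by (simp add: le_mod_geq)
  qed simp
qed

lemma sum_T_period:
  fixes f :: "int \<Rightarrow> int"
  shows "(\<Sum>i<p - 1. f (T i)) = 2 * int m * (f (T 0) + f (T 1) + f (T 2))"
proof -
  have "(\<Sum>i<p - 1. f (T i)) = (\<Sum>i<2 * m * 3. f (T (i mod 3)))"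
    by (simp add: T_mod_3 p_minus_1)
  also have "\<dots> = 2 * int m * (\<Sum>i<3. f (T i))"
    by (subst sum_lessThan_mod) simp
  finally show ?thesis by (simp add: eval_nat_numeral)
qed

lemma cube_cong_0_iff:
  assumes "x \<in> R"
  shows "[x ^ 3 = 0] (mod int p) \<longleftrightarrow> x = 0"
proof -
  have "[x ^ 3 = 0] (mod int p) \<longleftrightarrow> int p dvd x"
    using prime_p by (simp add: cong_0_iff prime_dvd_power_iff)
  then show ?thesis using assms zdvd_not_zless[of x "int p"] by fastforce
qed

lemma sum_indicator_0: "(\<Sum>x\<in>R. if [x ^ 3 = 0] (mod int p) then c else 0) = (c :: int)"
proof -
  have "(\<Sum>x\<in>R. if [x ^ 3 = 0] (mod int p) then c else 0) = (\<Sum>x\<in>R. if x = 0 then c else 0)"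
    by (intro sum.cong refl) (simp_all add: cube_cong_0_iff)
  also have "\<dots> = c" using p_gt_2 by simp
  finally show ?thesis .
qed

text \<open>Over all exponents the \<open>T i\<close> add up to the sum of
  \<open>chi a * S a\<close>. Summing over \<open>a\<close> first, every \<open>x\<close>
  contributes \<open>-1\<close> and \<open>x = 0\<close> an extra \<open>p\<close>, so the total is
  \<open>p - p\<close>.\<close>

lemma sum_T: "T 0 + T 1 + T 2 = 0"
proof -
  have "(\<Sum>i<p - 1. T i) = (\<Sum>a\<in>R. chi a * S a)"
    unfolding T_def by (subst sum_power_g) (simp_all add: S_mod)
  also have "\<dots> = (\<Sum>x\<in>R. \<Sum>a\<in>R. chi ((a + 0) * (a + x ^ 3)))"
    unfolding S_def sum_distrib_left by (subst sum.swap) (simp add: chi_mult add.commute)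
  also have "\<dots> = (\<Sum>x\<in>R. if [x ^ 3 = 0] (mod int p) then int p else 0) - (\<Sum>x\<in>R. 1)"
    unfolding sum_chi_mult by (simp add: sum_subtractf cong_sym_eq)
  also have "\<dots> = 0"
    unfolding sum_indicator_0 by simp
  finally show ?thesis
    using sum_T_period[of "\<lambda>x. x"] m_pos by simp
qed

text \<open>Zero pairs only with itself, and each of the \<open>6 * m\<close> nonzero residues
  shares its cube with exactly three residues.\<close>

lemma sum_cube_cong:
  "(\<Sum>x\<in>R. \<Sum>y\<in>R. if [x ^ 3 = y ^ 3] (mod int p) then 1 else 0 :: int) = 18 * int m + 1"
proof -
  define I where "I x y = (if [x ^ 3 = y ^ 3] (mod int p) then 1 else 0 :: int)" for x y :: int
  have I_mod: "I (x mod int p) y = I x y" "I x (y mod int p) = I x y" for x y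
    by (simp_all add: I_def cong_def mod_simps)
  have pow: "I (int g ^ i) (int g ^ j) = (if i mod (2 * m) = j mod (2 * m) then 1 else 0)" for i j
  proof -
    have "[(int g ^ i) ^ 3 = (int g ^ j) ^ 3] (mod int p) \<longleftrightarrow> i mod (2 * m) = j mod (2 * m)"
      unfolding power_mult[symmetric] power_g_cong_iff p_minus_1 triple_cong_iff ..
    then show ?thesis by (simp add: I_def)
  qed
  have row: "(\<Sum>j<p - 1. I (int g ^ i) (int g ^ j)) = 3" for i
  proof -
    have "(\<Sum>j<p - 1. I (int g ^ i) (int g ^ j)) =
        (\<Sum>j<3 * (2 * m). (\<lambda>r. if r = i mod (2 * m) then 1 else 0) (j mod (2 * m)))"
      by (intro sum.cong) (auto simp: pow p_minus_1)
    also have "\<dots> = 3"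
      by (subst sum_lessThan_mod) (use m_pos in simp)
    finally show ?thesis .
  qed
  have zero: "I 0 0 = 1" "I 0 (int g ^ i) = 0" "I (int g ^ i) 0 = 0" for i
    using power_g_not_cong_0[of "i * 3"] by (simp_all add: I_def cong_sym_eq flip: power_mult)
  have "(\<Sum>x\<in>R. \<Sum>y\<in>R. I x y) = (\<Sum>y\<in>R. I 0 y) + (\<Sum>i<p - 1. \<Sum>y\<in>R. I (int g ^ i) y)"
    by (rule sum_power_g) (simp add: I_mod)
  also have "(\<Sum>y\<in>R. I 0 y) = 1"
    by (subst sum_power_g) (simp_all add: I_mod zero)
  also have "(\<Sum>i<p - 1. \<Sum>y\<in>R. I (int g ^ i) y) = (\<Sum>i<p - 1. 3)"
    by (intro sum.cong refl, subst sum_power_g) (simp_all only: I_mod zero row add_0)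
  finally show ?thesis by (simp add: I_def p_minus_1)
qed

text \<open>Squaring removes the sign \<open>chi\<close>, leaving the second moment of
  \<open>S\<close>. By \<open>sum_chi_mult\<close> this is \<open>p\<close> times the number of
  pairs with equal cubes, minus \<open>p^2\<close>; it covers \<open>2 * m\<close> periods of
  \<open>T\<close>.\<close>

lemma sum_T_squares: "T 0 ^ 2 + T 1 ^ 2 + T 2 ^ 2 = 6 * int p"
proof -
  \<comment> \<open>The residue 0 is not a power of \<open>g\<close>, so its contribution to the
    second moment must vanish separately.\<close>
  have "S 0 = (\<Sum>x\<in>R. chi x)"
    unfolding S_def
  proof (rule sum.cong[OF refl])
    fix x
    show "chi (x ^ 3 + 0) = chi x"
      using Legendre_values[of x "int p"] by (auto simp: chi_power)
  qed
  then have "S 0 = 0" by (simp add: sum_chi)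
  then have "(\<Sum>i<p - 1. T i ^ 2) = (\<Sum>a\<in>R. S a ^ 2)"
    by (subst sum_power_g) (simp_all add: S_mod T_def power_mult_distrib Legendre_power2 power_g_not_cong_0)
  also have "\<dots> = (\<Sum>a\<in>R. \<Sum>x\<in>R. \<Sum>y\<in>R. chi ((a + x ^ 3) * (a + y ^ 3)))"
    unfolding S_def power2_eq_square sum_product by (simp add: chi_mult add.commute)
  also have "\<dots> = (\<Sum>x\<in>R. \<Sum>a\<in>R. \<Sum>y\<in>R. chi ((a + x ^ 3) * (a + y ^ 3)))"
    by (rule sum.swap)
  also have "\<dots> = (\<Sum>x\<in>R. \<Sum>y\<in>R. \<Sum>a\<in>R. chi ((a + x ^ 3) * (a + y ^ 3)))"
    by (intro sum.cong refl sum.swap)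
  also have "\<dots> = (\<Sum>x\<in>R. \<Sum>y\<in>R. int p * (if [x ^ 3 = y ^ 3] (mod int p) then 1 else 0) - 1)"
    unfolding sum_chi_mult by (intro sum.cong refl) simp
  also have "\<dots> = int p * (18 * int m + 1) - int p * int p"
    by (simp add: sum_subtractf sum_cube_cong flip: sum_distrib_left)
  also have "\<dots> = 2 * int m * (6 * int p)"
    by (simp add: p_eq algebra_simps)
  finally show ?thesis
    using sum_T_period[of "\<lambda>x. x ^ 2"] m_pos by simp
qed

text \<open>The residue 0 contributes 1, and every nonzero cube occurs three times. The remaining
  sum over \<open>2 * m\<close> exponents is odd, because its terms are 1 or \<open>-1\<close>
  except for a single zero where the cube is \<open>-1\<close>.\<close>

lemma S_1_mod_6: "\<exists>c. S 1 = 6 * c - 2"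
proof -
  define h where "h i = chi ((int g ^ i) ^ 3 + 1)" for i
  have h_mod: "h (i mod (2 * m)) = h i" for i
  proof -
    have "[(int g ^ (i mod (2 * m))) ^ 3 = (int g ^ i) ^ 3] (mod int p)"
      unfolding power_mult[symmetric] power_g_cong_iff p_minus_1 triple_cong_iff by simp
    then show ?thesis
      unfolding h_def by (intro Legendre_cong cong_add cong_refl)
  qed
  have "S 1 = 1 + (\<Sum>i<p - 1. h i)"
    unfolding S_def h_def by (subst sum_power_g) (simp_all add: chi_poly_mod)
  also have "(\<Sum>i<p - 1. h i) = (\<Sum>i<3 * (2 * m). h (i mod (2 * m)))"
    by (simp add: p_minus_1 h_mod)
  also have "\<dots> = 3 * (\<Sum>i<2 * m. h i)"
    by (subst sum_lessThan_mod) simp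
  finally have S1: "S 1 = 1 + 3 * (\<Sum>i<2 * m. h i)" .
  \<comment> \<open>Euler's criterion with \<open>chi g = -1\<close> says that
    \<open>g ^ (3 * m)\<close> is \<open>-1\<close>, so \<open>i = m\<close> gives the vanishing
    term.\<close>
  have odd_h: "odd (h i) \<longleftrightarrow> i \<noteq> m" if "i < 2 * m" for i
  proof -
    have half: "(p - 1) div 2 = m * 3" using p_minus_1 by simp
    have "[(int g ^ i) ^ 3 + 1 = 0] (mod int p) \<longleftrightarrow> [(int g ^ i) ^ 3 = -1] (mod int p)"
      by (simp add: cong_iff_dvd_diff)
    also have "\<dots> \<longleftrightarrow> [int g ^ (i * 3) = int g ^ (m * 3)] (mod int p)"
      using euler_g unfolding chi_g half power_mult by (metis cong_sym cong_trans)
    also have "\<dots> \<longleftrightarrow> i = m"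
      unfolding power_g_cong_iff p_minus_1 triple_cong_iff using that by simp
    finally show ?thesis by (simp add: h_def odd_Legendre_iff)
  qed
  have "{i\<in>{..<2 * m}. odd (h i)} = {..<2 * m} - {m}"
    using odd_h by auto
  then have "card {i\<in>{..<2 * m}. odd (h i)} = 2 * m - 1"
    using m_pos by simp
  then have "odd (\<Sum>i<2 * m. h i)"
    using m_pos by (simp add: even_sum_iff)
  then obtain c where "(\<Sum>i<2 * m. h i) = 2 * c + 1" by (rule oddE)
  then have "S 1 = 6 * (c + 1) - 2" using S1 by simp
  then show ?thesis by blast
qed

text \<open>The sum relation allows \<open>T 0 = -2A\<close>, \<open>T 1 = A + D\<close> and
  \<open>T 2 = A - D\<close>; the relation for squares then reads \<open>D^2 = 3 (p - A^2)\<close>.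
  So 3 divides \<open>D\<close>, and \<open>B = D / 3\<close>.\<close>

lemma S_1_representation: "\<exists>A B. S 1 = - 2 * A \<and> int p = A ^ 2 + 3 * B ^ 2 \<and> 3 dvd A - 1"
proof -
  obtain c where c: "S 1 = 6 * c - 2" using S_1_mod_6 by blast
  define A where "A = 1 - 3 * c"
  have T0: "T 0 = - 2 * A" using c by (simp add: T_def A_def)
  have sum12: "T 1 + T 2 = 2 * A" using sum_T T0 by simp
  then have "even (T 1 - T 2)" by presburger
  then obtain D where D: "T 1 - T 2 = 2 * D" by (rule evenE)
  have T12: "T 1 = A + D" "T 2 = A - D" using sum12 D by simp_all
  have D2: "D ^ 2 = 3 * (int p - A ^ 2)"
    using sum_T_squares unfolding T0 T12 by (simp add: power2_eq_square algebra_simps)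
  then have "3 dvd D ^ 2" by simp
  then have "3 dvd D" by (simp add: prime_dvd_power_iff)
  then obtain B where "D = 3 * B" by blast
  then have "int p = A ^ 2 + 3 * B ^ 2" using D2 by (simp add: power2_eq_square)
  moreover have "3 dvd A - 1" by (simp add: A_def)
  moreover have "S 1 = - 2 * A" using c by (simp add: A_def)
  ultimately show ?thesis by blast
qed

section \<open>Power sums modulo p and S(1) as a binomial coefficient\<close>

lemma power_sum_cong:
  assumes "0 < k"
  shows "[(\<Sum>x\<in>R. x ^ k) = (if (p - 1) dvd k then -1 else 0)] (mod int p)"
proof -
  \<comment> \<open>Reduction modulo \<open>p\<close> makes the summand periodic, as
    \<open>sum_power_g\<close> and \<open>sum_R_scale_g\<close> require.\<close>
  define f where "f x = x ^ k mod int p" for x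
  have f_mod: "f (x mod int p) = f x" for x by (simp add: f_def power_mod)
  have sum_f: "(\<Sum>x\<in>R. f x) = (\<Sum>i<p - 1. f (int g ^ i))"
    using assms by (subst sum_power_g) (simp_all add: f_mod, simp_all add: f_def zero_power)
  have "[(\<Sum>x\<in>R. x ^ k) = (\<Sum>i<p - 1. f (int g ^ i))] (mod int p)"
    unfolding sum_f[symmetric] by (intro cong_sum) (simp add: f_def cong_def)
  also have "[(\<Sum>i<p - 1. f (int g ^ i)) = (if (p - 1) dvd k then -1 else 0)] (mod int p)"
  proof (cases "(p - 1) dvd k")
    case True
    have "[f (int g ^ i) = 1] (mod int p)" for i
    proof -
      have "[int g ^ (i * k) = int g ^ 0] (mod int p)"
        using True unfolding power_g_cong_iff by (simp add: cong_0_iff)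
      then show ?thesis by (simp add: f_def cong_def power_mult)
    qed
    then have "[(\<Sum>i<p - 1. f (int g ^ i)) = (\<Sum>i<p - 1. 1)] (mod int p)"
      by (intro cong_sum)
    also have "(\<Sum>i<p - 1. 1) = int p + -1" using p_gt_2 by simp
    also have "[int p + -1 = 0 + -1] (mod int p)" by (intro cong_add) (simp_all add: cong_def)
    finally show ?thesis using True by simp
  next
    case False
    \<comment> \<open>Scaling by \<open>g\<close> permutes the residues but multiplies the sum by
      \<open>g ^ k\<close>, which is not 1 modulo \<open>p\<close>; the sum must therefore
      vanish.\<close>
    have "[(\<Sum>x\<in>R. f x) = (\<Sum>x\<in>R. f (int g * x))] (mod int p)"
      by (simp add: sum_R_scale_g f_mod)
    also have "[(\<Sum>x\<in>R. f (int g * x)) = (\<Sum>x\<in>R. int g ^ k * f x)] (mod int p)"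
      by (intro cong_sum) (simp add: f_def cong_def power_mult_distrib mod_simps)
    also have "(\<Sum>x\<in>R. int g ^ k * f x) = int g ^ k * (\<Sum>x\<in>R. f x)"
      by (simp add: sum_distrib_left)
    finally have "int p dvd (1 - int g ^ k) * (\<Sum>x\<in>R. f x)"
      by (simp add: cong_iff_dvd_diff left_diff_distrib)
    moreover have "\<not> int p dvd 1 - int g ^ k"
    proof
      assume "int p dvd 1 - int g ^ k"
      then have "[int g ^ 0 = int g ^ k] (mod int p)" by (simp add: cong_iff_dvd_diff)
      then show False
        using False cong_sym cong_0_iff unfolding power_g_cong_iff by blast
    qed
    ultimately have "int p dvd (\<Sum>x\<in>R. f x)"
      using prime_p by (simp add: prime_dvd_mult_iff)
    then show ?thesis
      using False by (simp only: sum_f cong_0_iff if_False)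
  qed
  finally show ?thesis .
qed

text \<open>Euler's criterion turns \<open>S 1\<close> into the sum of
  \<open>(x^3 + 1) ^ (3 * m)\<close>. After binomial expansion only the power sum with
  \<open>j = 2 * m\<close> survives, since \<open>6 * m\<close> must divide \<open>3 * j\<close>
  with \<open>0 < j <= 3 * m\<close>.\<close>

lemma S_1_cong: "[S 1 = - int (3 * m choose m)] (mod int p)"
proof -
  have half: "(p - 1) div 2 = 3 * m" using p_minus_1 by simp
  have "[S 1 = (\<Sum>x\<in>R. (x ^ 3 + 1) ^ (3 * m))] (mod int p)"
    unfolding S_def using euler_criterion[OF prime_p p_gt_2] half by (intro cong_sum) simp
  also have "(\<Sum>x\<in>R. (x ^ 3 + 1) ^ (3 * m)) = (\<Sum>x\<in>R. \<Sum>j\<le>3 * m. int (3 * m choose j) * x ^ (3 * j))"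
    by (simp add: binomial_ring flip: power_mult)
  also have "\<dots> = (\<Sum>j\<le>3 * m. int (3 * m choose j) * (\<Sum>x\<in>R. x ^ (3 * j)))"
    by (subst sum.swap) (simp add: sum_distrib_left)
  also have "[\<dots> = (\<Sum>j\<le>3 * m. int (3 * m choose j) * (if j = 2 * m then -1 else 0))] (mod int p)"
  proof (intro cong_sum cong_mult cong_refl)
    fix j assume "j \<in> {..3 * m}"
    show "[(\<Sum>x\<in>R. x ^ (3 * j)) = (if j = 2 * m then -1 else 0)] (mod int p)"
    proof (cases "j = 0")
      case True
      \<comment> \<open>For \<open>j = 0\<close> the summand is 1 even at \<open>x = 0\<close>, so
        the power sum is \<open>p\<close>, which is 0 and not \<open>-1\<close> modulo
        \<open>p\<close>.\<close>
      then show ?thesis using m_pos by (simp add: cong_0_iff)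
    next
      case False
      have "(p - 1) dvd 3 * j \<longleftrightarrow> 2 * m dvd j"
        using dvd_times_left_cancel_iff[of 3 "2 * m" j] by (simp add: p_minus_1)
      also have "\<dots> \<longleftrightarrow> j = 2 * m"
      proof
        assume "2 * m dvd j"
        then obtain k where k: "j = 2 * m * k" by blast
        then have "m * (2 * k) \<le> m * 3" using \<open>j \<in> {..3 * m}\<close> by simp
        then have "2 * k \<le> 3" using m_pos by (metis mult_le_cancel1)
        then have "k = 1" using False k by (cases k) auto
        then show "j = 2 * m" using k by simp
      qed simp
      finally show ?thesis using power_sum_cong[of "3 * j"] False by simp
    qed
  qed
  also have "(\<Sum>j\<le>3 * m. int (3 * m choose j) * (if j = 2 * m then -1 else 0)) =
      (\<Sum>j\<le>3 * m. if j = 2 * m then - int (3 * m choose j) else 0)"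
    by (intro sum.cong) auto
  also have "\<dots> = - int (3 * m choose (2 * m))"
    by simp
  also have "3 * m choose (2 * m) = 3 * m choose m"
    using binomial_symmetric[of "2 * m" "3 * m"] by simp
  finally show ?thesis .
qed

end

text \<open>Eliminating between the two representations shows that \<open>p\<close> divides
  \<open>(a * d - b * c) * (a * d + b * c)\<close>. A factor divisible by \<open>p\<close> must be
  zero for reasons of size, and then \<open>b ^ 2 = d ^ 2\<close>.\<close>

lemma representation_unique:
  fixes a b c d p :: int
  assumes "prime p" and ab: "p = a ^ 2 + 3 * b ^ 2" and cd: "p = c ^ 2 + 3 * d ^ 2"
  shows "a ^ 2 = c ^ 2"
proof -
  have key: "p * (w ^ 2 - y ^ 2) = (x * w - y * z) * (x * w + y * z)"
    if "p = x ^ 2 + 3 * y ^ 2" "p = z ^ 2 + 3 * w ^ 2" for x y z w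
  proof -
    have "p * w ^ 2 = (x ^ 2 + 3 * y ^ 2) * w ^ 2" using that(1) by simp
    moreover have "p * y ^ 2 = (z ^ 2 + 3 * w ^ 2) * y ^ 2" using that(2) by simp
    ultimately show ?thesis by (simp add: power2_eq_square algebra_simps)
  qed
  have main: "x ^ 2 = z ^ 2"
    if "p = x ^ 2 + 3 * y ^ 2" "p = z ^ 2 + 3 * w ^ 2" "p dvd x * w - y * z" for x y z w
  proof -
    \<comment> \<open>Brahmagupta's identity; a nonzero multiple of \<open>p\<close> in the last
      square would make the right side at least \<open>3 * p ^ 2\<close>.\<close>
    have pp: "p ^ 2 = (x * z + 3 * y * w) ^ 2 + 3 * (x * w - y * z) ^ 2"
    proof -
      have "p ^ 2 = (x ^ 2 + 3 * y ^ 2) * (z ^ 2 + 3 * w ^ 2)"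
        using that(1,2) by (metis power2_eq_square)
      then show ?thesis by (simp add: power2_eq_square algebra_simps)
    qed
    have "x * w - y * z = 0"
    proof (rule ccontr)
      assume "x * w - y * z \<noteq> 0"
      then have "\<bar>p\<bar> \<le> \<bar>x * w - y * z\<bar>" using that(3) by (rule dvd_imp_le_int)
      then have "p ^ 2 \<le> (x * w - y * z) ^ 2" by (simp add: abs_le_square_iff)
      moreover have "0 < p ^ 2" using prime_gt_0_int[OF assms(1)] by simp
      moreover have "0 \<le> (x * z + 3 * y * w) ^ 2" by simp
      ultimately show False using pp by linarith
    qed
    then have "w ^ 2 = y ^ 2"
      using key[OF that(1,2)] prime_gt_0_int[OF assms(1)] by simp
    then show ?thesis using that(1,2) by simp
  qed
  have "p * (d ^ 2 - b ^ 2) = (a * d - b * c) * (a * d + b * c)"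
    by (rule key[OF ab cd])
  then have "p dvd (a * d - b * c) * (a * d + b * c)" by (metis dvd_triv_left)
  \<comment> \<open>Replacing \<open>b\<close> by \<open>-b\<close> reduces the second factor to the
    case treated in \<open>main\<close>.\<close>
  then have "p dvd a * d - b * c \<or> p dvd a * d - (- b) * c"
    using assms(1) by (simp add: prime_dvd_mult_iff)
  then show ?thesis
    using main[of a b c d] main[of a "- b" c d] ab cd by auto
qed

lemma binomial_cong_representation:
  fixes A B :: int
  assumes "prime p" "p = 6 * m + 1" and AB: "int p = A ^ 2 + 3 * B ^ 2" "3 dvd A - 1"
  shows "[int (3 * m choose m) = 2 * A] (mod int p)"
proof -
  have "m > 0" using assms(1,2) by (cases m) auto
  then have "p > 2" using assms(2) by simp
  obtain g where "residue_primroot p g"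
    using prime_primitive_root_exists[of p] assms(1) \<open>p > 2\<close> by auto
  then interpret cubic_char_sum p g m
    using assms(1,2) \<open>p > 2\<close> by unfold_locales
  obtain C D where CD: "S 1 = - 2 * C" "int p = C ^ 2 + 3 * D ^ 2" "3 dvd C - 1"
    using S_1_representation by blast
  have "A ^ 2 = C ^ 2"
    by (rule representation_unique[OF _ AB(1) CD(2)]) (use assms(1) in simp)
  then have "A = C \<or> A = - C" by (simp add: power2_eq_iff)
  \<comment> \<open>Both numbers are 1 modulo 3, which excludes \<open>A = - C\<close>.\<close>
  then have "A = C" using AB(2) CD(3) by presburger
  then show ?thesis
    using S_1_cong CD(1) by (metis cong_minus_minus_iff cong_sym minus_mult_left)
qed

section \<open>Assembly over the two residue classes of p modulo 6\<close>

theorem theorem2p5: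
  fixes p :: nat
  assumes "prime p" and "p > 5"
  shows "((6::int) dvd (int p - 5) \<longrightarrow>
            rat_cong (\<Sum>k = 0..p div 3. of_nat (fact (3*k)) / (54 ^ k * of_nat (fact k) ^ 3)) 0 (int p))
       \<and> (\<forall>A B :: int. (6::int) dvd (int p - 1) \<and> int p = A^2 + 3 * B^2 \<and> (3::int) dvd (A - 1) \<longrightarrow>
            rat_cong (\<Sum>k = 0..p div 3. of_nat (fact (3*k)) / (54 ^ k * of_nat (fact k) ^ 3)) (2 * of_int A) (int p))
       \<and> ((6::int) dvd (int p - 1) \<longrightarrow>
            rat_cong (\<Sum>k = 0..p div 3. of_nat k * of_nat (fact (3*k)) / (54 ^ k * of_nat (fact k) ^ 3)) 0 (int p))
       \<and> ((6::int) dvd (int p - 5) \<longrightarrow>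
            rat_cong (\<Sum>k = 0..p div 3. of_nat k * of_nat (fact (3*k)) / (54 ^ k * of_nat (fact k) ^ 3))
              (1/3 * (-1) ^ ((p + 1) div 6) * inverse (2 ^ ((p + 1) div 3))
                 * of_nat (((p + 1) div 3) choose ((p + 1) div 6))) (int p))"
proof -
  have p: "prime p" "p > 5" by (rule assms)+
  have p': "prime (int p)" using p(1) by simp
  have S0: "(\<Sum>k = 0..p div 3. of_nat (fact (3*k)) / (54 ^ k * of_nat (fact k) ^ 3)) =
      (\<Sum>k = 0..p div 3. sum_term k)"
    by (simp only: sum_term_def)
  have S1: "(\<Sum>k = 0..p div 3. of_nat k * of_nat (fact (3*k)) / (54 ^ k * of_nat (fact k) ^ 3)) =
      (\<Sum>k = 0..p div 3. of_nat k * sum_term k)"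
    by (simp only: sum_term_def times_divide_eq_right)
  have five: "rat_cong (\<Sum>k = 0..p div 3. sum_term k) 0 (int p) \<and>
      rat_cong (\<Sum>k = 0..p div 3. of_nat k * sum_term k)
        (1/3 * (-1) ^ ((p + 1) div 6) * inverse (2 ^ ((p + 1) div 3))
                 * of_nat (((p + 1) div 3) choose ((p + 1) div 6))) (int p)"
    if "6 dvd int p - 5"
  proof -
    have "6 dvd p - 5" using that p(2) by presburger
    then obtain m where "p - 5 = 6 * m" by blast
    then have m: "p = 6 * m + 5" using p(2) by simp
    \<comment> \<open>The degree is odd here, so the Legendre value at zero vanishes and the
      derivative supplies the binomial coefficient.\<close>
    have n: "p div 3 = 2 * m + 1" "(p + 1) div 6 = m + 1" "(p + 1) div 3 = 2 * m + 2"
      using m by simp_all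
    have "p = 3 * (2 * m + 1) + 1 \<or> p = 3 * (2 * m + 1) + 2" using m by simp
    note sums = sum_term_sum_cong[OF p this]
    show ?thesis
      unfolding n using sums rat_cong_trans[OF p' sums(2) legendre_0'_cong[OF p(1) m]]
      by (simp only: legendre_0_odd)
  qed
  have one: "rat_cong (\<Sum>k = 0..p div 3. of_nat k * sum_term k) 0 (int p) \<and>
      (\<forall>A B. int p = A ^ 2 + 3 * B ^ 2 \<and> 3 dvd A - 1 \<longrightarrow>
        rat_cong (\<Sum>k = 0..p div 3. sum_term k) (2 * of_int A) (int p))"
    if "6 dvd int p - 1"
  proof (intro conjI allI impI)
    have "6 dvd p - 1" using that p(2) by presburger
    then obtain m where "p - 1 = 6 * m" by blast
    then have m: "p = 6 * m + 1" using p(2) by simp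
    \<comment> \<open>The degree is even here, so the roles are exchanged: the derivative at zero
      vanishes and the value supplies \<open>2 * A\<close>.\<close>
    have n: "p div 3 = 2 * m" using m by simp
    have "p = 3 * (2 * m) + 1 \<or> p = 3 * (2 * m) + 2" using m by simp
    note sums = sum_term_sum_cong[OF p this]
    show "rat_cong (\<Sum>k = 0..p div 3. of_nat k * sum_term k) 0 (int p)"
      unfolding n using sums(2) by (simp only: legendre_0'_even)
    fix A B :: int
    assume AB: "int p = A ^ 2 + 3 * B ^ 2 \<and> 3 dvd A - 1"
    then have "[int (3 * m choose m) = 2 * A] (mod int p)"
      using binomial_cong_representation[OF p(1) m] by blast
    then have "rat_cong (of_nat (3 * m choose m)) (2 * of_int A) (int p)"
      using rat_cong_of_int[OF _ p'] by fastforce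
    then show "rat_cong (\<Sum>k = 0..p div 3. sum_term k) (2 * of_int A) (int p)"
      unfolding n
      using rat_cong_trans[OF p'] sums(1) legendre_0_cong[OF p(1) m] by blast
  qed
  show ?thesis
    unfolding S0 S1 using five one by blast
qed

end
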